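(* Let $Q$ be a wide decomposable subcategory of a finite lattice $P$. The following are equivalent: (1) there is a model structure on $P$ with $Q$ as the class of weak equivalences; (2) there is a model structure on $P$ with weak equivalences $Q$ and acyclic fibrations $T_{max}$, where $T_{max}$ is the join of all transfer systems on $P$ that are contained in $Q$; (3) for every morphism $f$ in $Q$ there exists a factorization $f=\sigma_n\circ\sigma_{n-1}\circ\cdots\circ\sigma_1$ into short arrows such that for some $0\le k\le n$ both of the following hold: for any $i\le k$, all pushouts of $\sigma_i$ are in $Q$; and for any $i>k$, all pullbacks of $\sigma_i$ are in $Q$.
   Context: A finite lattice $P$ is regarded as a category whose objects are the elements of $P$, with a unique arrow $a\to b$ whenever $a\le b$. A wide subcategory is one containing all objects; a subcategory $D$ of $P$ is decomposable if whenever $f,g$ are composable morphisms of $P$ with $g\circ f\in D$, then $f\in D$ and $g\in D$. Subcategories containing all objects are identified with their collections of morphisms, and $\subseteq$ is containment of morphisms. The pullbacks of $x\to y$ are the arrows $x\wedge z\to z$ for $z\le y$; the pushouts of $x\to y$ are the arrows $z\to y\vee z$ for $z\ge x$. A morphism $\sigma$ in $P$ is a short arrow if $\sigma=\sigma_2\circ\sigma_1$ implies that $\sigma_1$ or $\sigma_2$ is an identity. A transfer system on $P$ is a partial order $R$ on the set $P$ such that $xRy$ implies $x\le y$, and $xRy$, $z\le y$ imply $(x\wedge z)Rz$; equivalently, a wide subcategory of $P$ closed under pullbacks. The set $\mathrm{Tr}(P)$ of transfer systems, ordered by inclusion, is a lattice; the join of transfer systems is the smallest transfer system containing all of them. (A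 join of transfer systems contained in a wide subcategory $Q$ is again contained in $Q$, so $T_{max}$ is the largest transfer system contained in $Q$.) For arrows $i\colon a\to b$ and $p\colon x\to y$, $i$ has the left lifting property with respect to $p$ (and $p$ the right lifting property with respect to $i$) if every commutative square from $i$ to $p$ has a diagonal lift $b\to x$. A weak factorization system on $P$ is a pair $(L,R)$ of classes of morphisms such that every morphism factors as $p\circ i$ with $i\in L$, $p\in R$; $L$ is the class of all morphisms with the left lifting property against all of $R$; and $R$ is the class of all morphisms with the right lifting property against all of $L$. A model structure on $P$ consists of two weak factorization systems $(\mathsf{AC},\mathsf{F})$ and $(\mathsf{C},\mathsf{AF})$ with $\mathsf{AC}\subseteq\mathsf{C}$ such that $\mathsf{W}:=\mathsf{AF}\circ\mathsf{AC}=\{p\circ i: i\in\mathsf{AC},\,p\in\mathsf{AF}\}$ satisfies the two-out-of-three axiom. $\mathsf{W}$ is the class of weak equivalences, $\mathsf{F}$ fibrations, $\mathsf{C}$ cofibrations, $\mathsf{AF}$ acyclic fibrations, $\mathsf{AC}$ acyclic cofibrations. *)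

theory Defs
  imports Main
begin

text \<open>
  A finite lattice is a type of class \<open>{finite, lattice}\<close>. The arrow \<open>a \<rightarrow> b\<close> of the poset
  category is the pair \<open>(a, b)\<close> with \<open>a \<le> b\<close>; classes of morphisms are relations. For
  relations \<open>S\<close>, \<open>T\<close>, the composites \<open>g \<circ> f\<close> with \<open>f \<in> S\<close> and \<open>g \<in> T\<close> form \<open>S O T\<close>.
\<close>

definition arrows :: "('a::order \<times> 'a) set" where
  "arrows = {(a, b). a \<le> b}"

definition wide_subcategory :: "('a::order \<times> 'a) set \<Rightarrow> bool" where
  "wide_subcategory D \<longleftrightarrow> D \<subseteq> arrows \<and> Id \<subseteq> D \<and> trans D"

definition decomposable :: "('a::order \<times> 'a) set \<Rightarrow> bool" where
  "decomposable D \<longleftrightarrow>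
    (\<forall>a b c. a \<le> b \<longrightarrow> b \<le> c \<longrightarrow> (a, c) \<in> D \<longrightarrow> (a, b) \<in> D \<and> (b, c) \<in> D)"

definition pullbacks :: "'a::lattice \<times> 'a \<Rightarrow> ('a \<times> 'a) set" where
  "pullbacks f = {(inf (fst f) z, z) | z. z \<le> snd f}"

definition pushouts :: "'a::lattice \<times> 'a \<Rightarrow> ('a \<times> 'a) set" where
  "pushouts f = {(z, sup (snd f) z) | z. fst f \<le> z}"

text \<open>Identities count as short arrows.\<close>

definition short_arrow :: "'a::order \<times> 'a \<Rightarrow> bool" where
  "short_arrow f \<longleftrightarrow> f \<in> arrows \<and>
    (\<forall>z. (fst f, z) \<in> arrows \<longrightarrow> (z, snd f) \<in> arrows \<longrightarrow> fst f = z \<or> z = snd f)"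

definition transfer_system :: "('a::lattice \<times> 'a) set \<Rightarrow> bool" where
  "transfer_system R \<longleftrightarrow> partial_order_on UNIV R \<and>
    (\<forall>x y. (x, y) \<in> R \<longrightarrow> x \<le> y) \<and>
    (\<forall>x y z. (x, y) \<in> R \<longrightarrow> z \<le> y \<longrightarrow> (inf x z, z) \<in> R)"

definition transfer_join :: "('a::lattice \<times> 'a) set set \<Rightarrow> ('a \<times> 'a) set" where
  "transfer_join \<S> = (LEAST R. transfer_system R \<and> (\<forall>S\<in>\<S>. S \<subseteq> R))"

definition T_max :: "('a::lattice \<times> 'a) set \<Rightarrow> ('a \<times> 'a) set" where
  "T_max Q = transfer_join {R. transfer_system R \<and> R \<subseteq> Q}"

text \<open>The two triangles formed with a diagonal commute automatically in a poset.\<close>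

definition lifts :: "'a::order \<times> 'a \<Rightarrow> 'a \<times> 'a \<Rightarrow> bool" where
  "lifts i p \<longleftrightarrow>
    ((fst i, fst p) \<in> arrows \<longrightarrow> (snd i, snd p) \<in> arrows \<longrightarrow> (snd i, fst p) \<in> arrows)"

definition weak_factorization_system ::
    "('a::order \<times> 'a) set \<Rightarrow> ('a \<times> 'a) set \<Rightarrow> bool" where
  "weak_factorization_system L R \<longleftrightarrow>
    arrows \<subseteq> L O R \<and>
    L = {i \<in> arrows. \<forall>p\<in>R. lifts i p} \<and>
    R = {p \<in> arrows. \<forall>i\<in>L. lifts i p}"

definition two_out_of_three :: "('a::order \<times> 'a) set \<Rightarrow> bool" where
  "two_out_of_three W \<longleftrightarrow> (\<forall>a b c. a \<le> b \<longrightarrow> b \<le> c \<longrightarrow>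
    ((a, b) \<in> W \<and> (b, c) \<in> W \<longrightarrow> (a, c) \<in> W) \<and>
    ((a, b) \<in> W \<and> (a, c) \<in> W \<longrightarrow> (b, c) \<in> W) \<and>
    ((b, c) \<in> W \<and> (a, c) \<in> W \<longrightarrow> (a, b) \<in> W))"

definition weak_equivalences ::
    "('a::order \<times> 'a) set \<Rightarrow> ('a \<times> 'a) set \<Rightarrow> ('a \<times> 'a) set" where
  "weak_equivalences AC AF = AC O AF"

definition model_structure ::
    "('a::order \<times> 'a) set \<Rightarrow> ('a \<times> 'a) set \<Rightarrow> ('a \<times> 'a) set \<Rightarrow> ('a \<times> 'a) set \<Rightarrow> bool" where
  "model_structure AC F C AF \<longleftrightarrow>
    weak_factorization_system AC F \<and>
    weak_factorization_system C AF \<and>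
    AC \<subseteq> C \<and>
    two_out_of_three (weak_equivalences AC AF)"

text \<open>
  A composable string of arrows is given by its objects:
  \<open>\<sigma>\<^sub>i\<close> is the arrow \<open>(x (i - 1), x i)\<close> for \<open>1 \<le> i \<le> n\<close>. The case \<open>n = 0\<close> is the empty
  factorization of an identity.
\<close>

definition short_factorization :: "'a::order \<times> 'a \<Rightarrow> nat \<Rightarrow> (nat \<Rightarrow> 'a) \<Rightarrow> bool" where
  "short_factorization f n x \<longleftrightarrow>
    x 0 = fst f \<and> x n = snd f \<and> (\<forall>i\<in>{1..n}. short_arrow (x (i - 1), x i))"

text \<open>The least transfer system in the definition of the join exists.\<close>

lemma transfer_system_arrows: "transfer_system (arrows :: ('a::lattice \<times> 'a) set)"
  by (auto simp: transfer_system_def arrows_def partial_order_on_def preorder_on_def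
      intro!: refl_onI transI antisymI)

lemma transfer_system_Inter:
  assumes "\<And>R. R \<in> \<R> \<Longrightarrow> transfer_system R" and "\<R> \<noteq> {}"
  shows "transfer_system (\<Inter>\<R> :: ('a::lattice \<times> 'a) set)"
proof -
  have "refl (\<Inter>\<R>)"
    using assms(1) by (fastforce simp: transfer_system_def partial_order_on_def preorder_on_def
        refl_on_def)
  moreover have "trans (\<Inter>\<R>)"
    using assms(1) by (intro trans_INTER[of \<R> id, simplified])
      (simp add: transfer_system_def partial_order_on_def preorder_on_def)
  moreover have "antisym (\<Inter>\<R>)"
    using assms by (metis Inter_lower antisym_subset ex_in_conv partial_order_on_def
        transfer_system_def)
  moreover have "x \<le> y" if "(x, y) \<in> \<Inter>\<R>" for x y
    using assms that unfolding transfer_system_def by blast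
  moreover have "(inf x z, z) \<in> \<Inter>\<R>" if "(x, y) \<in> \<Inter>\<R>" "z \<le> y" for x y z
    using assms that unfolding transfer_system_def by blast
  ultimately show ?thesis
    by (simp add: transfer_system_def partial_order_on_def preorder_on_def)
qed

lemma transfer_join_eq_Inter:
  "transfer_join \<S> = \<Inter>{R. transfer_system R \<and> (\<forall>S\<in>\<S>. S \<subseteq> R)}"
  if "\<And>S. S \<in> \<S> \<Longrightarrow> transfer_system (S :: ('a::lattice \<times> 'a) set)"
  unfolding transfer_join_def
proof (rule Least_equality)
  have "arrows \<in> {R. transfer_system R \<and> (\<forall>S\<in>\<S>. S \<subseteq> R)}"
    using that transfer_system_arrows by (auto simp: transfer_system_def arrows_def)
  then show "transfer_system (\<Inter>{R. transfer_system R \<and> (\<forall>S\<in>\<S>. S \<subseteq> R)}) \<and>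
      (\<forall>S\<in>\<S>. S \<subseteq> \<Inter>{R. transfer_system R \<and> (\<forall>S\<in>\<S>. S \<subseteq> R)})"
    by (intro conjI transfer_system_Inter) blast+
qed blast

end

theory Submission
  imports Defs
begin

text \<open>
  Let \<open>K\<close> be the class of arrows all of whose pullbacks lie in \<open>Q\<close>, and \<open>M\<close> the class of
  arrows all of whose pushouts lie in \<open>Q\<close>. Both contain the identities, are closed under
  composition, and inherit decomposability from \<open>Q\<close>; moreover \<open>K\<close> is stable under pullbacks,
  and is therefore \<open>T_max Q\<close> (\<open>T_max_eq_pullback_stable\<close>), while \<open>M\<close> is stable under pushouts.
  The three conditions are all equivalent to \<open>Q \<subseteq> M O K\<close>.

  For the factorizations into short arrows this holds because arrows of a finite poset can be
  refined into short ones, and the refinement stays inside a decomposable class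
  (\<open>ex_short_factorization_stable_iff\<close>).

  If \<open>Q\<close> is the class of weak equivalences of a model structure, then \<open>AF\<close> is stable under
  pullbacks and \<open>AC\<close> under pushouts, and both lie in \<open>Q\<close>. Hence \<open>AC \<subseteq> M\<close> and \<open>AF \<subseteq> K\<close>, so
  \<open>Q = AC O AF \<subseteq> M O K\<close>.

  Conversely suppose \<open>Q \<subseteq> M O K\<close>. In a finite lattice every transfer system is the right class
  of a weak factorization system, so \<open>K\<close> can serve as acyclic fibrations, with cofibrations
  \<open>C\<close>. The acyclic cofibrations are forced to be \<open>C \<inter> Q\<close>, and the point is that this class is
  stable under pushouts. Indeed, factor an arrow \<open>a \<rightarrow> b\<close> of \<open>C \<inter> Q\<close> through \<open>m\<close> with
  \<open>(a, m) \<in> M\<close> and \<open>(m, b) \<in> K\<close>; lifting \<open>a \<rightarrow> b\<close> against \<open>m \<rightarrow> b\<close> gives \<open>b = m\<close>, so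
  \<open>(a, b) \<in> M\<close>. Thus \<open>C \<inter> Q = C \<inter> M\<close>, an intersection of two classes stable under pushouts
  and composition, and the dual of the statement on transfer systems makes it the left class of
  a weak factorization system. The weak equivalences of the resulting model structure are again
  \<open>Q\<close>: factor an arrow of \<open>Q\<close> into \<open>C\<close> followed by \<open>K\<close>, and the first factor lies in \<open>Q\<close>
  by decomposability. The two-out-of-three axiom is composition in \<open>Q\<close> together with
  decomposability.
\<close>

section \<open>Weak factorization systems on a finite lattice\<close>

text \<open>
  A poset has no proper retracts: if \<open>a \<rightarrow> b\<close> factors as \<open>a \<rightarrow> m \<rightarrow> b\<close> and lifts against
  \<open>m \<rightarrow> b\<close>, then \<open>m = b\<close>. So the retract argument here shows that factorizations and lifts
  alone make \<open>L\<close> and \<open>R\<close> determine each other.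
\<close>

lemma weak_factorization_systemI:
  assumes LR: "L \<subseteq> arrows" "R \<subseteq> arrows"
    and factor: "arrows \<subseteq> L O R"
    and lift: "\<And>i p. i \<in> L \<Longrightarrow> p \<in> R \<Longrightarrow> lifts i p"
  shows "weak_factorization_system L R"
proof -
  have "(a, b) \<in> L" if ab: "(a, b) \<in> arrows" and llp: "\<forall>p\<in>R. lifts (a, b) p" for a b
  proof -
    obtain m where m: "(a, m) \<in> L" "(m, b) \<in> R" using factor ab by blast
    have "m = b"
      using llp m LR by (fastforce simp: lifts_def arrows_def)
    with m show ?thesis by simp
  qed
  moreover have "(a, b) \<in> R" if ab: "(a, b) \<in> arrows" and rlp: "\<forall>i\<in>L. lifts i (a, b)" for a b
  proof -
    obtain m where m: "(a, m) \<in> L" "(m, b) \<in> R" using factor ab by blast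
    have "m = a"
      using rlp m LR by (fastforce simp: lifts_def arrows_def)
    with m show ?thesis by simp
  qed
  ultimately show ?thesis
    using LR factor lift by (auto simp: weak_factorization_system_def)
qed

lemma weak_factorization_systemD:
  assumes "weak_factorization_system L R"
  shows "L \<subseteq> arrows" "R \<subseteq> arrows" "Id \<subseteq> L" "Id \<subseteq> R" "arrows \<subseteq> L O R"
    and "L = {i \<in> arrows. \<forall>p\<in>R. lifts i p}" "R = {p \<in> arrows. \<forall>i\<in>L. lifts i p}"
proof -
  note wfs = assms[unfolded weak_factorization_system_def]
  show L: "L = {i \<in> arrows. \<forall>p\<in>R. lifts i p}" and R: "R = {p \<in> arrows. \<forall>i\<in>L. lifts i p}"
    and "arrows \<subseteq> L O R"
    using wfs by blast+
  show "L \<subseteq> arrows" "R \<subseteq> arrows" using L R by blast+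
  show "Id \<subseteq> L" by (subst L) (auto simp: lifts_def arrows_def)
  show "Id \<subseteq> R" by (subst R) (auto simp: lifts_def arrows_def)
qed

lemma llp_pushout:
  fixes a b z :: "'a::lattice"
  assumes "lifts (a, b) p" "a \<le> z"
  shows "lifts (z, sup b z) p"
  using assms by (auto simp: lifts_def arrows_def)

lemma llp_comp:
  assumes "lifts (a, b) p" "lifts (b, c) p" "b \<le> c"
  shows "lifts (a, c) p"
  using assms by (auto simp: lifts_def arrows_def)

lemma rlp_pullback:
  fixes x y z :: "'a::lattice"
  assumes "lifts i (x, y)" "z \<le> y"
  shows "lifts i (inf x z, z)"
  using assms by (auto simp: lifts_def arrows_def)

lemma wfs_pullback:
  fixes x y z :: "'a::lattice"
  assumes "weak_factorization_system L R" "(x, y) \<in> R" "z \<le> y"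
  shows "(inf x z, z) \<in> R"
proof -
  note R = weak_factorization_systemD(7)[OF assms(1)]
  have "\<forall>i\<in>L. lifts i (x, y)" using assms(2) by (subst (asm) R) simp
  then have "\<forall>i\<in>L. lifts i (inf x z, z)" using rlp_pullback assms(3) by blast
  then show ?thesis by (subst R) (simp add: arrows_def)
qed

lemma wfs_pushout:
  fixes x y z :: "'a::lattice"
  assumes "weak_factorization_system L R" "(x, y) \<in> L" "x \<le> z"
  shows "(z, sup y z) \<in> L"
proof -
  note L = weak_factorization_systemD(6)[OF assms(1)]
  have "\<forall>p\<in>R. lifts (x, y) p" using assms(2) by (subst (asm) L) simp
  then have "\<forall>p\<in>R. lifts (z, sup y z) p" using llp_pushout assms(3) by blast
  then show ?thesis by (subst L) (simp add: arrows_def)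
qed

lemma wfs_trans_left:
  assumes "weak_factorization_system L R"
  shows "trans L"
proof (rule transI)
  fix a b c assume "(a, b) \<in> L" "(b, c) \<in> L"
  then show "(a, c) \<in> L"
    using weak_factorization_systemD(6)[OF assms] llp_comp[of a b _ c]
    by (auto simp: arrows_def)
qed

text \<open>
  The middle object of a factorization will be the least (or, dually, the greatest) member of
  such a family. This is where finiteness of the lattice matters for factorizations: a minimal
  member exists, and closure under meets makes it the least one.
\<close>

lemma finite_inf_closed_has_least:
  fixes A :: "'a::{finite, lattice} set"
  assumes "A \<noteq> {}" and "\<And>x y. x \<in> A \<Longrightarrow> y \<in> A \<Longrightarrow> inf x y \<in> A"
  obtains m where "m \<in> A" "\<And>x. x \<in> A \<Longrightarrow> m \<le> x"
proof -
  obtain m where m: "m \<in> A" "\<And>x. x \<in> A \<Longrightarrow> x \<le> m \<Longrightarrow> m = x"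
    using finite_has_minimal[OF _ assms(1)] by (metis finite)
  have "inf m x = m" if "x \<in> A" for x
    using m(2)[OF assms(2)[OF m(1) that]] by simp
  then show ?thesis using that m(1) by (metis inf.absorb_iff1)
qed

lemma finite_sup_closed_has_greatest:
  fixes A :: "'a::{finite, lattice} set"
  assumes "A \<noteq> {}" and "\<And>x y. x \<in> A \<Longrightarrow> y \<in> A \<Longrightarrow> sup x y \<in> A"
  obtains m where "m \<in> A" "\<And>x. x \<in> A \<Longrightarrow> x \<le> m"
proof -
  obtain m where m: "m \<in> A" "\<And>x. x \<in> A \<Longrightarrow> m \<le> x \<Longrightarrow> m = x"
    using finite_has_maximal[OF _ assms(1)] by (metis finite)
  have "sup m x = m" if "x \<in> A" for x
    using m(2)[OF assms(2)[OF m(1) that]] by simp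
  then show ?thesis using that m(1) by (metis sup.absorb_iff1)
qed

text \<open>
  The factorization of \<open>a \<rightarrow> b\<close> goes through the least \<open>m \<ge> a\<close> with \<open>(m, b) \<in> R\<close>: a lifting
  problem of \<open>a \<rightarrow> m\<close> against \<open>x \<rightarrow> y\<close> in \<open>R\<close> pulls back to \<open>x \<sqinter> m \<rightarrow> m\<close>, and minimality of
  \<open>m\<close> forces \<open>m \<le> x\<close>.
\<close>

lemma transfer_system_wfs:
  fixes R :: "('a::{finite, lattice} \<times> 'a) set"
  assumes "transfer_system R"
  shows "weak_factorization_system {i \<in> arrows. \<forall>p\<in>R. lifts i p} R"
proof (rule weak_factorization_systemI)
  have R: "refl R" "trans R" "\<And>x y. (x, y) \<in> R \<Longrightarrow> x \<le> y"
    and pb: "\<And>x y z. (x, y) \<in> R \<Longrightarrow> z \<le> y \<Longrightarrow> (inf x z, z) \<in> R"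
    using assms by (auto simp: transfer_system_def partial_order_on_def preorder_on_def)
  show "R \<subseteq> arrows" using R by (auto simp: arrows_def)
  show "arrows \<subseteq> {i \<in> arrows. \<forall>p\<in>R. lifts i p} O R"
  proof clarify
    fix a b :: 'a assume ab: "(a, b) \<in> arrows"
    let ?A = "{m. a \<le> m \<and> (m, b) \<in> R}"
    have "b \<in> ?A" using R(1) ab by (auto simp: arrows_def refl_on_def)
    moreover have "inf x y \<in> ?A" if "x \<in> ?A" "y \<in> ?A" for x y
      using that pb[of x b y] R transD[OF R(2), of "inf x y" y b] by auto
    ultimately obtain m where m: "m \<in> ?A" and least: "\<And>x. x \<in> ?A \<Longrightarrow> m \<le> x"
      using finite_inf_closed_has_least[of ?A] by blast
    have "m \<le> x" if "(x, y) \<in> R" "a \<le> x" "m \<le> y" for x y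
    proof -
      have "(inf x m, b) \<in> R"
        using pb[OF that(1,3)] m transD[OF R(2)] by blast
      then have "m \<le> inf x m" using that(2) m by (intro least) auto
      then show ?thesis by simp
    qed
    then have "(a, m) \<in> {i \<in> arrows. \<forall>p\<in>R. lifts i p}"
      using m by (auto simp: lifts_def arrows_def)
    then show "(a, b) \<in> {i \<in> arrows. \<forall>p\<in>R. lifts i p} O R"
      using m by blast
  qed
qed auto

text \<open>
  The order dual of the preceding argument: here \<open>m\<close> is the greatest \<open>m \<le> b\<close> with
  \<open>(a, m) \<in> L\<close>.
\<close>

lemma pushout_closed_wfs:
  fixes L :: "('a::{finite, lattice} \<times> 'a) set"
  assumes L: "wide_subcategory L"
    and po: "\<And>x y z. (x, y) \<in> L \<Longrightarrow> x \<le> z \<Longrightarrow> (z, sup y z) \<in> L"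
  shows "weak_factorization_system L {p \<in> arrows. \<forall>i\<in>L. lifts i p}"
proof (rule weak_factorization_systemI)
  have tr: "trans L" using L by (simp add: wide_subcategory_def)
  show arr: "L \<subseteq> arrows" using L by (simp add: wide_subcategory_def)
  show "arrows \<subseteq> L O {p \<in> arrows. \<forall>i\<in>L. lifts i p}"
  proof clarify
    fix a b :: 'a assume ab: "(a, b) \<in> arrows"
    let ?A = "{m. m \<le> b \<and> (a, m) \<in> L}"
    have "a \<in> ?A" using L ab by (auto simp: arrows_def wide_subcategory_def)
    moreover have "sup x y \<in> ?A" if "x \<in> ?A" "y \<in> ?A" for x y
      using that po[of a x y] arr transD[OF tr, of a y "sup x y"] by (auto simp: arrows_def)
    ultimately obtain m where m: "m \<in> ?A" and greatest: "\<And>x. x \<in> ?A \<Longrightarrow> x \<le> m"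
      using finite_sup_closed_has_greatest[of ?A] by blast
    have "y \<le> m" if "(x, y) \<in> L" "x \<le> m" "y \<le> b" for x y
    proof -
      have "(a, sup y m) \<in> L"
        using po[OF that(1,2)] m transD[OF tr] by blast
      then have "sup y m \<le> m" using that(3) m by (intro greatest) auto
      then show ?thesis by simp
    qed
    then have "(m, b) \<in> {p \<in> arrows. \<forall>i\<in>L. lifts i p}"
      using m by (auto simp: lifts_def arrows_def)
    then show "(a, b) \<in> L O {p \<in> arrows. \<forall>i\<in>L. lifts i p}"
      using m by blast
  qed
qed auto

section \<open>Arrows whose pullbacks or pushouts stay in a class\<close>

definition pullback_stable :: "('a::lattice \<times> 'a) set \<Rightarrow> ('a \<times> 'a) set" where
  "pullback_stable Q = {f \<in> arrows. pullbacks f \<subseteq> Q}"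

definition pushout_stable :: "('a::lattice \<times> 'a) set \<Rightarrow> ('a \<times> 'a) set" where
  "pushout_stable Q = {f \<in> arrows. pushouts f \<subseteq> Q}"

lemma pullback_stable_iff:
  "(x, y) \<in> pullback_stable Q \<longleftrightarrow> x \<le> y \<and> (\<forall>z\<le>y. (inf x z, z) \<in> Q)"
  by (auto simp: pullback_stable_def pullbacks_def arrows_def)

lemma pushout_stable_iff:
  "(x, y) \<in> pushout_stable Q \<longleftrightarrow> x \<le> y \<and> (\<forall>z\<ge>x. (z, sup y z) \<in> Q)"
  by (auto simp: pushout_stable_def pushouts_def arrows_def)

lemma pullback_stable_subset: "pullback_stable Q \<subseteq> Q"
proof clarify
  fix x y assume "(x, y) \<in> pullback_stable Q"
  then have "x \<le> y" "(inf x y, y) \<in> Q" by (simp_all add: pullback_stable_iff)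
  then show "(x, y) \<in> Q" by (simp add: inf.absorb1)
qed

lemma pushout_stable_subset: "pushout_stable Q \<subseteq> Q"
proof clarify
  fix x y assume "(x, y) \<in> pushout_stable Q"
  then have "x \<le> y" "(x, sup y x) \<in> Q" by (simp_all add: pushout_stable_iff)
  then show "(x, y) \<in> Q" by (simp add: sup.absorb1)
qed

lemma pullback_stable_pullback:
  assumes "(x, y) \<in> pullback_stable Q" "z \<le> y"
  shows "(inf x z, z) \<in> pullback_stable Q"
  using assms by (auto simp: pullback_stable_iff inf.assoc inf.absorb2)

lemma pushout_stable_pushout:
  assumes "(x, y) \<in> pushout_stable Q" "x \<le> z"
  shows "(z, sup y z) \<in> pushout_stable Q"
  using assms by (auto simp: pushout_stable_iff sup.assoc sup.absorb2)

text \<open>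
  A pullback of a composite is a composite of pullbacks: \<open>x \<sqinter> w \<rightarrow> w\<close> passes through
  \<open>y \<sqinter> w\<close>, and \<open>x \<sqinter> w = x \<sqinter> (y \<sqinter> w)\<close>.
\<close>

lemma wide_subcategory_pullback_stable:
  assumes Q: "wide_subcategory Q"
  shows "wide_subcategory (pullback_stable Q)"
proof -
  have "trans (pullback_stable Q)"
  proof (rule transI)
    fix x y z assume xy: "(x, y) \<in> pullback_stable Q" and yz: "(y, z) \<in> pullback_stable Q"
    have "(inf x w, w) \<in> Q" if "w \<le> z" for w
    proof -
      have "(inf x (inf y w), inf y w) \<in> Q" using xy by (auto simp: pullback_stable_iff)
      moreover have "inf x (inf y w) = inf x w"
        using xy by (simp add: pullback_stable_iff inf.absorb1 flip: inf.assoc)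
      moreover have "(inf y w, w) \<in> Q" using yz that by (auto simp: pullback_stable_iff)
      ultimately show ?thesis using Q by (metis transD wide_subcategory_def)
    qed
    then show "(x, z) \<in> pullback_stable Q" using xy yz by (auto simp: pullback_stable_iff)
  qed
  moreover have "Id \<subseteq> pullback_stable Q"
    using Q by (auto simp: pullback_stable_iff wide_subcategory_def inf.absorb2)
  ultimately show ?thesis by (auto simp: wide_subcategory_def pullback_stable_def)
qed

lemma wide_subcategory_pushout_stable:
  assumes Q: "wide_subcategory Q"
  shows "wide_subcategory (pushout_stable Q)"
proof -
  have "trans (pushout_stable Q)"
  proof (rule transI)
    fix x y z assume xy: "(x, y) \<in> pushout_stable Q" and yz: "(y, z) \<in> pushout_stable Q"
    have "(w, sup z w) \<in> Q" if "x \<le> w" for w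
    proof -
      have "(sup y w, sup z (sup y w)) \<in> Q" using yz by (auto simp: pushout_stable_iff)
      moreover have "sup z (sup y w) = sup z w"
        using yz by (simp add: pushout_stable_iff sup.absorb1 flip: sup.assoc)
      moreover have "(w, sup y w) \<in> Q" using xy that by (auto simp: pushout_stable_iff)
      ultimately show ?thesis using Q by (metis transD wide_subcategory_def)
    qed
    then show "(x, z) \<in> pushout_stable Q" using xy yz by (auto simp: pushout_stable_iff)
  qed
  moreover have "Id \<subseteq> pushout_stable Q"
    using Q by (auto simp: pushout_stable_iff wide_subcategory_def sup.absorb2)
  ultimately show ?thesis by (auto simp: wide_subcategory_def pushout_stable_def)
qed

text \<open>
  For \<open>a \<le> b \<le> c\<close>, the arrow \<open>a \<rightarrow> b\<close> is itself a pullback of \<open>a \<rightarrow> c\<close>, and each pullback of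
  \<open>b \<rightarrow> c\<close> is the second factor of the corresponding pullback of \<open>a \<rightarrow> c\<close>.
\<close>

lemma decomposable_pullback_stable:
  assumes Q: "decomposable Q"
  shows "decomposable (pullback_stable Q)"
  unfolding decomposable_def
proof (intro allI impI conjI)
  fix a b c assume le: "a \<le> b" "b \<le> c" and ac: "(a, c) \<in> pullback_stable Q"
  show "(a, b) \<in> pullback_stable Q"
    using pullback_stable_pullback[OF ac le(2)] le by (simp add: inf.absorb1)
  have "(inf b z, z) \<in> Q" if "z \<le> c" for z
  proof -
    have "(inf a z, z) \<in> Q" using ac that by (simp add: pullback_stable_iff)
    moreover have "inf a z \<le> inf b z" using le by (intro inf_mono) auto
    ultimately show ?thesis using Q by (meson decomposable_def inf_le2)
  qed
  then show "(b, c) \<in> pullback_stable Q" using le by (simp add: pullback_stable_iff)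
qed

lemma decomposable_pushout_stable:
  assumes Q: "decomposable Q"
  shows "decomposable (pushout_stable Q)"
  unfolding decomposable_def
proof (intro allI impI conjI)
  fix a b c assume le: "a \<le> b" "b \<le> c" and ac: "(a, c) \<in> pushout_stable Q"
  show "(b, c) \<in> pushout_stable Q"
    using pushout_stable_pushout[OF ac le(1)] le by (simp add: sup.absorb1)
  have "(z, sup b z) \<in> Q" if "a \<le> z" for z
  proof -
    have "(z, sup c z) \<in> Q" using ac that by (simp add: pushout_stable_iff)
    moreover have "sup b z \<le> sup c z" using le by (intro sup_mono) auto
    ultimately show ?thesis using Q by (meson decomposable_def sup_ge2)
  qed
  then show "(a, b) \<in> pushout_stable Q" using le by (simp add: pushout_stable_iff)
qed

lemma transfer_system_pullback_stable:
  fixes Q :: "('a::lattice \<times> 'a) set"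
  assumes "wide_subcategory Q"
  shows "transfer_system (pullback_stable Q)"
proof -
  have K: "pullback_stable Q \<subseteq> arrows" "Id \<subseteq> pullback_stable Q" "trans (pullback_stable Q)"
    using wide_subcategory_pullback_stable[OF assms] by (auto simp: wide_subcategory_def)
  have "antisym (arrows :: ('a \<times> 'a) set)" by (auto simp: arrows_def antisym_def)
  then have "antisym (pullback_stable Q)" by (rule antisym_subset[OF K(1)])
  moreover have "refl (pullback_stable Q)" using K(2) by (auto simp: refl_on_def)
  ultimately show ?thesis
    using K pullback_stable_pullback
    by (auto simp: transfer_system_def partial_order_on_def preorder_on_def arrows_def)
qed

text \<open>
  \<open>pullback_stable Q\<close> is itself one of the transfer systems joined in \<open>T_max Q\<close>, and it
  contains every other one, since a transfer system inside \<open>Q\<close> has all its pullbacks in \<open>Q\<close>.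
\<close>

lemma T_max_eq_pullback_stable:
  assumes "wide_subcategory Q"
  shows "T_max Q = pullback_stable Q"
  unfolding T_max_def transfer_join_def
proof (rule Least_equality)
  have "S \<subseteq> pullback_stable Q" if "transfer_system S" "S \<subseteq> Q" for S
    using that(1) subsetD[OF that(2)] by (auto simp: transfer_system_def pullback_stable_iff)
  then show "transfer_system (pullback_stable Q) \<and>
      (\<forall>S\<in>{R. transfer_system R \<and> R \<subseteq> Q}. S \<subseteq> pullback_stable Q)"
    using transfer_system_pullback_stable[OF assms] by blast
next
  fix R assume "transfer_system R \<and> (\<forall>S\<in>{R. transfer_system R \<and> R \<subseteq> Q}. S \<subseteq> R)"
  then show "pullback_stable Q \<le> R"
    using transfer_system_pullback_stable[OF assms] pullback_stable_subset by blast
qed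

section \<open>Factorizations into short arrows\<close>

lemma chain_in_wide_subcategory:
  fixes x :: "nat \<Rightarrow> 'a::order"
  assumes "wide_subcategory R" "j \<le> l" "\<forall>i\<in>{j<..l}. (x (i - 1), x i) \<in> R"
  shows "(x j, x l) \<in> R"
  using assms(2,3)
proof (induction l rule: dec_induct)
  case base
  then show ?case using assms(1) by (auto simp: wide_subcategory_def)
next
  case (step l)
  then have "(x j, x l) \<in> R" by auto
  moreover have "(x l, x (Suc l)) \<in> R" using step.prems[rule_format, of "Suc l"] step.hyps by simp
  ultimately show ?case using assms(1) by (meson transD wide_subcategory_def)
qed

lemma append_chains:
  fixes x y :: "nat \<Rightarrow> 'a"
  assumes x: "\<forall>i\<in>{1..n}. (x (i - 1), x i) \<in> R" and y: "\<forall>i\<in>{1..m}. (y (i - 1), y i) \<in> S"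
    and xy: "x n = y 0"
  obtains z where "z 0 = x 0" "z (n + m) = y m"
    "\<forall>i\<in>{1..n}. (z (i - 1), z i) \<in> R" "\<forall>i\<in>{n<..n+m}. (z (i - 1), z i) \<in> S"
proof
  define z where "z i = (if i \<le> n then x i else y (i - n))" for i
  show "z 0 = x 0" "z (n + m) = y m" using xy by (auto simp: z_def)
  show "\<forall>i\<in>{1..n}. (z (i - 1), z i) \<in> R" using x by (auto simp: z_def)
  show "\<forall>i\<in>{n<..n+m}. (z (i - 1), z i) \<in> S"
  proof
    fix i assume i: "i \<in> {n<..n+m}"
    then have "i - n \<in> {1..m}" by auto
    then have "(y (i - n - 1), y (i - n)) \<in> S" using y by blast
    moreover have "z (i - 1) = y (i - n - 1)"
      using i xy by (cases "i = Suc n") (auto simp: z_def)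
    ultimately show "(z (i - 1), z i) \<in> S" using i by (simp add: z_def)
  qed
qed

text \<open>
  An arrow that is not short splits at an object strictly between its ends, and both halves span
  smaller intervals.
\<close>

lemma decomposable_short_chain:
  fixes R :: "('a::{finite, order} \<times> 'a) set"
  assumes R: "R \<subseteq> arrows" "decomposable R"
  shows "(a, b) \<in> R \<Longrightarrow>
    \<exists>(n::nat) x. x 0 = a \<and> x n = b \<and> (\<forall>i\<in>{1..n}. (x (i - 1), x i) \<in> R \<inter> Collect short_arrow)"
proof (induction "card {a..b}" arbitrary: a b rule: less_induct)
  case less
  show ?case
  proof (cases "short_arrow (a, b)")
    case True
    with less.prems show ?thesis
      by (intro exI[of _ 1] exI[of _ "\<lambda>i. if i = 0 then a else b"]) auto
  next
    case False
    then obtain c where c: "a \<le> c" "c \<le> b" "a \<noteq> c" "c \<noteq> b"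
      using less.prems R(1) by (auto simp: short_arrow_def arrows_def)
    have "{a..c} \<subset> {a..b}" "{c..b} \<subset> {a..b}" using c by auto
    then have card: "card {a..c} < card {a..b}" "card {c..b} < card {a..b}"
      by (auto intro: psubset_card_mono)
    have ac: "(a, c) \<in> R" and cb: "(c, b) \<in> R"
      using R(2) less.prems c by (auto simp: decomposable_def)
    obtain n :: nat and x where x: "x 0 = a" "x n = c"
        "\<forall>i\<in>{1..n}. (x (i - 1), x i) \<in> R \<inter> Collect short_arrow"
      using less.hyps[OF card(1) ac] by blast
    obtain m :: nat and y where y: "y 0 = c" "y m = b"
        "\<forall>i\<in>{1..m}. (y (i - 1), y i) \<in> R \<inter> Collect short_arrow"
      using less.hyps[OF card(2) cb] by blast
    have xy: "x n = y 0" using x(2) y(1) by simp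
    obtain z where z: "z 0 = x 0" "z (n + m) = y m"
        "\<forall>i\<in>{1..n}. (z (i - 1), z i) \<in> R \<inter> Collect short_arrow"
        "\<forall>i\<in>{n<..n+m}. (z (i - 1), z i) \<in> R \<inter> Collect short_arrow"
      by (rule append_chains[OF x(3) y(3) xy])
    have "(z (i - 1), z i) \<in> R \<inter> Collect short_arrow" if "i \<in> {1..n+m}" for i
      using z(3,4) that by (cases "i \<le> n") auto
    with z(1,2) x(1) y(2) show ?thesis by blast
  qed
qed

text \<open>
  The factorization condition only depends on the object \<open>x k\<close> at which the string switches from
  pushout-stable to pullback-stable arrows. The arrows before and after it compose to one arrow
  each, and conversely decomposability lets both arrows be refined into short ones.
\<close>

lemma ex_short_factorization_stable_iff:
  fixes Q :: "('a::{finite, lattice} \<times> 'a) set"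
  assumes Q: "wide_subcategory Q" "decomposable Q"
  shows "(\<exists>n x. short_factorization (a, b) n x \<and>
      (\<exists>k\<le>n. (\<forall>i\<in>{1..k}. pushouts (x (i - 1), x i) \<subseteq> Q) \<and>
              (\<forall>i\<in>{k<..n}. pullbacks (x (i - 1), x i) \<subseteq> Q)))
    \<longleftrightarrow> (a, b) \<in> pushout_stable Q O pullback_stable Q"
    (is "?L \<longleftrightarrow> ?R")
proof
  assume ?L
  then obtain n x k where x: "short_factorization (a, b) n x" and k: "k \<le> n"
    and po: "\<forall>i\<in>{1..k}. pushouts (x (i - 1), x i) \<subseteq> Q"
    and pb: "\<forall>i\<in>{k<..n}. pullbacks (x (i - 1), x i) \<subseteq> Q"
    by blast
  have arr: "(x (i - 1), x i) \<in> arrows" if "i \<in> {1..n}" for i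
    using x that by (auto simp: short_factorization_def short_arrow_def)
  have "(x 0, x k) \<in> pushout_stable Q"
    using po arr k
    by (intro chain_in_wide_subcategory wide_subcategory_pushout_stable Q)
      (auto simp: pushout_stable_def)
  moreover have "(x k, x n) \<in> pullback_stable Q"
    using pb arr k
    by (intro chain_in_wide_subcategory wide_subcategory_pullback_stable Q)
      (auto simp: pullback_stable_def)
  ultimately show ?R using x by (auto simp: short_factorization_def)
next
  assume ?R
  then obtain c where c: "(a, c) \<in> pushout_stable Q" "(c, b) \<in> pullback_stable Q" by blast
  have arr: "pushout_stable Q \<subseteq> arrows" "pullback_stable Q \<subseteq> arrows"
    by (auto simp: pushout_stable_def pullback_stable_def)
  obtain k :: nat and x where x: "x 0 = a" "x k = c"
      "\<forall>i\<in>{1..k}. (x (i - 1), x i) \<in> pushout_stable Q \<inter> Collect short_arrow"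
    using decomposable_short_chain[OF arr(1) decomposable_pushout_stable[OF Q(2)] c(1)] by blast
  obtain m :: nat and y where y: "y 0 = c" "y m = b"
      "\<forall>i\<in>{1..m}. (y (i - 1), y i) \<in> pullback_stable Q \<inter> Collect short_arrow"
    using decomposable_short_chain[OF arr(2) decomposable_pullback_stable[OF Q(2)] c(2)] by blast
  have xy: "x k = y 0" using x(2) y(1) by simp
  obtain z where z: "z 0 = x 0" "z (k + m) = y m"
      "\<forall>i\<in>{1..k}. (z (i - 1), z i) \<in> pushout_stable Q \<inter> Collect short_arrow"
      "\<forall>i\<in>{k<..k+m}. (z (i - 1), z i) \<in> pullback_stable Q \<inter> Collect short_arrow"
    by (rule append_chains[OF x(3) y(3) xy])
  have "short_arrow (z (i - 1), z i)" if "i \<in> {1..k+m}" for i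
    using z(3,4) that by (cases "i \<le> k") auto
  then have "short_factorization (a, b) (k + m) z"
    using z(1,2) x(1) y(2) by (simp add: short_factorization_def)
  moreover have "\<forall>i\<in>{1..k}. pushouts (z (i - 1), z i) \<subseteq> Q"
    "\<forall>i\<in>{k<..k+m}. pullbacks (z (i - 1), z i) \<subseteq> Q"
    using z(3,4) by (auto simp: pushout_stable_def pullback_stable_def)
  ultimately show ?L by (meson le_add1)
qed

section \<open>Model structures with prescribed weak equivalences\<close>

text \<open>
  Identities are both acyclic cofibrations and acyclic fibrations, so \<open>AC\<close> and \<open>AF\<close> lie in
  \<open>Q\<close>; their own stability under pushouts and pullbacks does the rest.
\<close>

lemma model_structure_weak_equivalences_subset:
  fixes Q :: "('a::lattice \<times> 'a) set"
  assumes "model_structure AC F C AF" and W: "weak_equivalences AC AF = Q"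
  shows "Q \<subseteq> pushout_stable Q O pullback_stable Q"
proof -
  have AC: "weak_factorization_system AC F" and AF: "weak_factorization_system C AF"
    using assms by (auto simp: model_structure_def)
  note ACD = weak_factorization_systemD[OF AC] and AFD = weak_factorization_systemD[OF AF]
  have sub: "AC \<subseteq> Q" "AF \<subseteq> Q"
    using W ACD(3) AFD(4) by (auto simp: weak_equivalences_def)
  have "AC \<subseteq> pushout_stable Q"
    using wfs_pushout[OF AC] subsetD[OF sub(1)] subsetD[OF ACD(1)]
    by (auto simp: pushout_stable_iff arrows_def)
  moreover have "AF \<subseteq> pullback_stable Q"
    using wfs_pullback[OF AF] subsetD[OF sub(2)] subsetD[OF AFD(2)]
    by (auto simp: pullback_stable_iff arrows_def)
  ultimately show ?thesis
    using W by (auto simp: weak_equivalences_def)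
qed

lemma decomposable_two_out_of_three:
  fixes Q :: "('a::order \<times> 'a) set"
  assumes "wide_subcategory Q" "decomposable Q"
  shows "two_out_of_three Q"
  unfolding two_out_of_three_def
proof (intro allI impI conjI; elim conjE)
  fix a b c :: 'a assume le: "a \<le> b" "b \<le> c"
  show "(a, c) \<in> Q" if "(a, b) \<in> Q" "(b, c) \<in> Q"
    using assms(1) that by (auto simp: wide_subcategory_def dest: transD)
  show "(b, c) \<in> Q" "(a, b) \<in> Q" if "(a, c) \<in> Q"
    using assms(2) le that by (auto simp: decomposable_def)
qed

text \<open>
  The acyclic cofibrations must be the cofibrations that are weak equivalences. The assumed
  factorizations of arrows of \<open>Q\<close> show that these are pushout-stable, which makes them the
  left class of a weak factorization system.
\<close>

lemma model_structure_pullback_stable: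
  fixes Q :: "('a::{finite, lattice} \<times> 'a) set"
  assumes Q: "wide_subcategory Q" "decomposable Q"
    and sub: "Q \<subseteq> pushout_stable Q O pullback_stable Q"
  obtains AC F C where "model_structure AC F C (pullback_stable Q)"
    and "weak_equivalences AC (pullback_stable Q) = Q"
proof -
  let ?K = "pullback_stable Q"
  define C where "C = {i \<in> arrows. \<forall>p\<in>?K. lifts i p}"
  define AC where "AC = C \<inter> Q"
  have C: "weak_factorization_system C ?K"
    unfolding C_def by (rule transfer_system_wfs[OF transfer_system_pullback_stable[OF Q(1)]])
  note CD = weak_factorization_systemD[OF C]
  have AC: "AC = C \<inter> pushout_stable Q"
  proof
    show "C \<inter> pushout_stable Q \<subseteq> AC"
      using pushout_stable_subset by (auto simp: AC_def)
    show "AC \<subseteq> C \<inter> pushout_stable Q"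
    proof clarify
      fix a b assume ab: "(a, b) \<in> AC"
      then obtain m where m: "(a, m) \<in> pushout_stable Q" "(m, b) \<in> ?K"
        using sub by (auto simp: AC_def)
      have "lifts (a, b) (m, b)" using ab m by (auto simp: AC_def C_def)
      \<comment> \<open>The lift of \<open>a \<rightarrow> b\<close> against \<open>m \<rightarrow> b\<close> is an arrow \<open>b \<rightarrow> m\<close>.\<close>
      then have "b = m"
        using m by (auto simp: lifts_def arrows_def pushout_stable_iff pullback_stable_iff)
      with m ab show "(a, b) \<in> C \<inter> pushout_stable Q" by (auto simp: AC_def)
    qed
  qed
  have "wide_subcategory AC"
    using wide_subcategory_pushout_stable[OF Q(1)] CD(1,3) wfs_trans_left[OF C]
    by (auto simp: AC wide_subcategory_def intro: trans_Int)
  then have ACF: "weak_factorization_system AC {p \<in> arrows. \<forall>i\<in>AC. lifts i p}"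
    using wfs_pushout[OF C] pushout_stable_pushout[of _ _ Q]
    by (intro pushout_closed_wfs) (auto simp: AC)
  have W: "weak_equivalences AC ?K = Q"
  proof
    show "weak_equivalences AC ?K \<subseteq> Q"
      using pullback_stable_subset[of Q] transD[of Q] Q(1)
      by (auto simp: weak_equivalences_def AC_def wide_subcategory_def)
    show "Q \<subseteq> weak_equivalences AC ?K"
    proof clarify
      fix a b assume ab: "(a, b) \<in> Q"
      then have "(a, b) \<in> arrows" using Q(1) by (auto simp: wide_subcategory_def)
      then obtain m where m: "(a, m) \<in> C" "(m, b) \<in> ?K"
        using CD(5) by blast
      then have "a \<le> m" "m \<le> b" using CD(1,2) by (auto simp: arrows_def)
      then have "(a, m) \<in> Q" using ab Q(2) by (auto simp: decomposable_def)
      with m show "(a, b) \<in> weak_equivalences AC ?K"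
        by (auto simp: weak_equivalences_def AC_def)
    qed
  qed
  have "model_structure AC {p \<in> arrows. \<forall>i\<in>AC. lifts i p} C ?K"
    using ACF C decomposable_two_out_of_three[OF Q] W
    by (auto simp: model_structure_def AC_def)
  with W that show ?thesis by blast
qed

theorem theorem5p8:
  fixes Q :: "('a::{finite, lattice} \<times> 'a) set"
  assumes "wide_subcategory Q" and "decomposable Q"
  shows "((\<exists>AC F C AF. model_structure AC F C AF \<and> weak_equivalences AC AF = Q) \<longleftrightarrow>
          (\<exists>AC F C. model_structure AC F C (T_max Q) \<and> weak_equivalences AC (T_max Q) = Q))
       \<and> ((\<exists>AC F C. model_structure AC F C (T_max Q) \<and> weak_equivalences AC (T_max Q) = Q) \<longleftrightarrow>
          (\<forall>f\<in>Q. \<exists>n x. short_factorization f n x \<and>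
             (\<exists>k\<le>n. (\<forall>i\<in>{1..k}. pushouts (x (i - 1), x i) \<subseteq> Q) \<and>
                     (\<forall>i\<in>{k<..n}. pullbacks (x (i - 1), x i) \<subseteq> Q))))"
    (is "(?one \<longleftrightarrow> ?two) \<and> (?two \<longleftrightarrow> ?three)")
proof -
  let ?sub = "Q \<subseteq> pushout_stable Q O pullback_stable Q"
  have "?one \<Longrightarrow> ?sub"
    using model_structure_weak_equivalences_subset by blast
  moreover have "?sub \<Longrightarrow> ?two"
    using model_structure_pullback_stable[OF assms] T_max_eq_pullback_stable[OF assms(1)]
    by metis
  moreover have "?two \<Longrightarrow> ?one" by blast
  moreover have "?three \<longleftrightarrow> ?sub"
    unfolding subset_eq
  proof (rule ball_cong[OF refl])
    fix f show "(\<exists>n x. short_factorization f n x \<and>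
             (\<exists>k\<le>n. (\<forall>i\<in>{1..k}. \<forall>g\<in>pushouts (x (i - 1), x i). g \<in> Q) \<and>
                     (\<forall>i\<in>{k<..n}. \<forall>g\<in>pullbacks (x (i - 1), x i). g \<in> Q))) \<longleftrightarrow>
        f \<in> pushout_stable Q O pullback_stable Q"
      using ex_short_factorization_stable_iff[OF assms, of "fst f" "snd f"]
      by (simp only: prod.collapse subset_eq)
  qed
  ultimately show ?thesis by argo
qed

end
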